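(* Let $m, n \geq 1$ be two fixed integers, let $R$ be a $6mn(m+n)(2n+m)$-torsion free semiprime ring, and let $T: R\to R$ be a nonzero generalized $(m,n)$-Jordan centralizer. Then $T$ is a two-sided centralizer.
   Context: $R$ is an associative ring. For an integer $k\geq 2$, $R$ is $k$-torsion free if $kx=0$ implies $x=0$ for all $x\in R$. $R$ is semiprime if $aRa=\{0\}$ implies $a=0$. An additive map $T:R\to R$ is a left (resp. right) centralizer if $T(xy)=T(x)y$ (resp. $T(xy)=xT(y)$) for all $x,y\in R$, and a two-sided centralizer if it is both a left and a right centralizer. For fixed integers $m,n\geq 0$ with $m+n\neq 0$, an additive map $T_0:R\to R$ is an $(m,n)$-Jordan centralizer if $(m+n)T_0(x^2)=mT_0(x)x+nxT_0(x)$ for all $x\in R$; an additive map $T:R\to R$ is a generalized $(m,n)$-Jordan centralizer if there exists an $(m,n)$-Jordan centralizer $T_0:R\to R$ such that $(m+n)T(x^2)=mT(x)x+nxT_0(x)$ for all $x\in R$. *)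

theory Defs
  imports Main
begin

text \<open>Rings: Isabelle's class ring is an associative (not necessarily commutative,
not necessarily unital) ring.  Integer multiples k x are written nsm k x.\<close>

definition nsm :: "nat \<Rightarrow> 'a::ab_group_add \<Rightarrow> 'a" where
  "nsm k x = (\<Sum>i<k. x)"

definition torsion_free :: "nat \<Rightarrow> 'a::ring itself \<Rightarrow> bool" where
  "torsion_free k (_::'a itself) \<longleftrightarrow> (\<forall>x::'a. nsm k x = 0 \<longrightarrow> x = 0)"

definition semiprime :: "'a::ring itself \<Rightarrow> bool" where
  "semiprime (_::'a itself) \<longleftrightarrow> (\<forall>a::'a. (\<forall>r. a * r * a = 0) \<longrightarrow> a = 0)"

definition additive :: "('a::ring \<Rightarrow> 'a) \<Rightarrow> bool" where
  "additive T \<longleftrightarrow> (\<forall>x y. T (x + y) = T x + T y)"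

definition left_centralizer :: "('a::ring \<Rightarrow> 'a) \<Rightarrow> bool" where
  "left_centralizer T \<longleftrightarrow> additive T \<and> (\<forall>x y. T (x * y) = T x * y)"

definition right_centralizer :: "('a::ring \<Rightarrow> 'a) \<Rightarrow> bool" where
  "right_centralizer T \<longleftrightarrow> additive T \<and> (\<forall>x y. T (x * y) = x * T y)"

definition two_sided_centralizer :: "('a::ring \<Rightarrow> 'a) \<Rightarrow> bool" where
  "two_sided_centralizer T \<longleftrightarrow> left_centralizer T \<and> right_centralizer T"

definition mn_jordan_centralizer :: "nat \<Rightarrow> nat \<Rightarrow> ('a::ring \<Rightarrow> 'a) \<Rightarrow> bool" where
  "mn_jordan_centralizer m n T0 \<longleftrightarrow> additive T0 \<and>
     (\<forall>x. nsm (m + n) (T0 (x * x)) = nsm m (T0 x * x) + nsm n (x * T0 x))"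

definition generalized_mn_jordan_centralizer :: "nat \<Rightarrow> nat \<Rightarrow> ('a::ring \<Rightarrow> 'a) \<Rightarrow> bool" where
  "generalized_mn_jordan_centralizer m n T \<longleftrightarrow> additive T \<and>
     (\<exists>T0. mn_jordan_centralizer m n T0 \<and>
        (\<forall>x. nsm (m + n) (T (x * x)) = nsm m (T x * x) + nsm n (x * T0 x)))"

end

theory Submission
  imports Defs
begin

text \<open>
  Write \<open>a \<circ> b = ab + ba\<close> and \<open>U\<^sub>a v = m v a + n a v\<close>. An \<open>(m,n)\<close>-Jordan centralizer \<open>T\<^sub>0\<close>
  satisfies \<open>(m+n) T\<^sub>0(a \<circ> b) = U\<^sub>b T\<^sub>0(a) + U\<^sub>a T\<^sub>0(b)\<close>, so applying \<open>T\<^sub>0\<close> to the Jordan identity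
  gives a relation that is linear in an arbitrary \<open>y\<close> and involves only \<open>x\<close> and \<open>t = T\<^sub>0(x)\<close>.
  Comparing its instances at \<open>y\<close>, \<open>xy\<close>, \<open>yx\<close> and \<open>ty\<close> yields relations for \<open>d = [t, x]\<close> which by
  semiprimeness collapse to \<open>d R x\<^sup>2 = 0\<close>; linearizing this in \<open>x\<close> forces \<open>d = 0\<close>. Hence
  \<open>T\<^sub>0(x\<^sup>2) = T\<^sub>0(x) x = x T\<^sub>0(x)\<close>, and \<open>T\<^sub>0\<close> is a two-sided centralizer by Zalar's argument.

  The difference \<open>S = T - T\<^sub>0\<close> satisfies \<open>(m+n) S(x\<^sup>2) = m S(x) x\<close>, the same situation with left
  weight \<open>0\<close>. The Jordan identity now gives \<open>(m + 2n) S(x) x\<^sup>3 = 0\<close>, and then successively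
  \<open>S(x) x\<^sup>2 = 0\<close>, \<open>S(x) x = 0\<close> and \<open>S = 0\<close>.
\<close>

section \<open>Integer multiples, torsion, semiprimeness and additive maps\<close>

lemma nsm_0 [simp]: "nsm 0 x = 0"
  by (simp add: nsm_def)

lemma nsm_Suc: "nsm (Suc k) x = nsm k x + x"
  by (simp add: nsm_def)

lemma nsm_zero [simp]: "nsm k 0 = 0"
  by (simp add: nsm_def)

lemma nsm_add: "nsm (j + k) x = nsm j x + nsm k x"
  by (induction k) (simp_all add: nsm_Suc add_ac)

lemma nsm_add_right: "nsm k (x + y) = nsm k x + nsm k y"
  by (simp add: nsm_def sum.distrib)

lemma nsm_minus_right: "nsm k (- x) = - nsm k x"
  by (simp add: nsm_def sum_negf)

lemma nsm_diff_right: "nsm k (x - y) = nsm k x - nsm k y"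
  by (simp add: nsm_def sum_subtractf)

lemma nsm_mult: "nsm (j * k) x = nsm j (nsm k x)"
  by (induction j) (simp_all add: nsm_Suc nsm_add add_ac)

lemma nsm_commute: "nsm j (nsm k x) = nsm k (nsm j x)"
  by (simp add: mult.commute flip: nsm_mult)

lemma nsm_mult_left: "nsm k x * y = nsm k (x * y)"
  for x :: "'a::ring"
  by (simp add: nsm_def sum_distrib_right)

lemma nsm_mult_right: "x * nsm k y = nsm k (x * y)"
  for x :: "'a::ring"
  by (simp add: nsm_def sum_distrib_left)

lemma nsm_2: "nsm 2 x = x + x"
  by (simp add: numeral_2_eq_2 nsm_Suc)

lemmas nsm_simps = nsm_add nsm_add_right nsm_minus_right nsm_diff_right
  nsm_mult_left nsm_mult_right

lemma torsion_free_cancel: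
  assumes "torsion_free k TYPE('a::ring)" "nsm k x = nsm k (y::'a)"
  shows "x = y"
proof -
  have "nsm k (x - y) = 0"
    using assms(2) by (simp add: nsm_diff_right)
  then have "x - y = 0"
    using assms(1) unfolding torsion_free_def by blast
  then show ?thesis
    by simp
qed

lemma torsion_free_multD:
  assumes "torsion_free (j * k) TYPE('a::ring)"
  shows "torsion_free j TYPE('a)" "torsion_free k TYPE('a)"
  using assms by (auto simp: torsion_free_def nsm_mult) (simp add: nsm_commute[of j k])

lemma semiprimeD:
  assumes "semiprime TYPE('a::ring)" "\<And>r. a * r * a = (0::'a)"
  shows "a = 0"
  using assms unfolding semiprime_def by blast

text \<open>Without a unit, the products \<open>r * s * u\<close> need not exhaust the ring, so
  semiprimeness is used twice: for \<open>a\<close> and for \<open>a * r * a\<close>.\<close>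

lemma semiprime_cubeD:
  assumes sp: "semiprime TYPE('a::ring)" and a: "\<And>r s u. a * r * s * u * a = (0::'a)"
  shows "a = 0"
proof (rule semiprimeD[OF sp])
  fix r
  show "a * r * a = 0"
  proof (rule semiprimeD[OF sp])
    fix s
    show "a * r * a * s * (a * r * a) = 0"
      using a[of "r" "a" "s * a * r"] by (simp add: mult.assoc)
  qed
qed

text \<open>Sandwiching any \<open>s\<close> between two copies of \<open>b * r * a\<close> produces
  the zero factor \<open>a * s * b\<close>.\<close>

lemma semiprime_annihilator_sym:
  assumes sp: "semiprime TYPE('a::ring)" and ab: "\<And>r. a * r * b = (0::'a)"
  shows "b * r * a = 0"
proof (rule semiprimeD[OF sp])
  fix s
  have "b * r * a * s * (b * r * a) = b * r * (a * s * b) * r * a"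
    by (simp add: mult.assoc)
  then show "b * r * a * s * (b * r * a) = 0"
    by (simp add: ab)
qed

lemma additive_add: "additive T \<Longrightarrow> T (x + y) = T x + T y"
  by (simp add: additive_def)

lemma additive_0: "additive T \<Longrightarrow> T 0 = 0"
  using additive_add[of T 0 0] by simp

lemma additive_minus: "additive T \<Longrightarrow> T (- x) = - T x"
  using additive_add[of T x "- x"] by (simp add: additive_0 eq_neg_iff_add_eq_0 add.commute)

lemma additive_diff: "additive T \<Longrightarrow> T (x - y) = T x - T y"
  using additive_add[of T x "- y"] by (simp add: additive_minus)

section \<open>Weighted multiplications and the Jordan identity\<close>

text \<open>Free weights let one identity serve both \<open>T0\<close>, with weights
  \<open>m\<close> and \<open>n\<close>, and \<open>S\<close>, with weights \<open>m\<close> and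
  \<open>0\<close>.\<close>

definition weighted_mult :: "nat \<Rightarrow> nat \<Rightarrow> 'a::ring \<Rightarrow> 'a \<Rightarrow> 'a" where
  "weighted_mult p q a v = nsm p (v * a) + nsm q (a * v)"

lemma weighted_mult_add: "weighted_mult p q a (v + w) = weighted_mult p q a v + weighted_mult p q a w"
  by (simp add: weighted_mult_def nsm_simps algebra_simps)

lemma weighted_mult_nsm: "weighted_mult p q a (nsm k v) = nsm k (weighted_mult p q a v)"
  by (simp add: weighted_mult_def nsm_simps nsm_commute[of k])

lemma weighted_mult_sq_commute:
  "weighted_mult p q x (weighted_mult p q (x * x) v) =
   weighted_mult p q (x * x) (weighted_mult p q x v)"
  by (simp add: weighted_mult_def nsm_simps nsm_commute[of q p] algebra_simps)

lemma weighted_jordan_linearized: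
  assumes add: "additive T"
    and sq: "\<And>x. nsm k (T (x * x)) = weighted_mult p q x (T x)"
  shows "nsm k (T (a * b + b * a)) = weighted_mult p q b (T a) + weighted_mult p q a (T b)"
proof -
  have "(a + b) * (a + b) = a * a + (a * b + b * a) + b * b"
    by (simp add: algebra_simps)
  then have "nsm k (T ((a + b) * (a + b))) =
      nsm k (T (a * a)) + nsm k (T (a * b + b * a)) + nsm k (T (b * b))"
    by (simp only: additive_add[OF add] nsm_add_right)
  then show ?thesis
    unfolding sq by (simp add: weighted_mult_def additive_add[OF add] nsm_simps algebra_simps)
qed

text \<open>The Jordan identity \<open>(x\<^sup>2 \<circ> y) \<circ> x = x\<^sup>2 \<circ> (y \<circ> x)\<close>: the two terms containing
  \<open>T y\<close> agree because multiplications by \<open>x\<close> and \<open>x\<^sup>2\<close> commute.\<close>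

lemma weighted_jordan_identity:
  fixes T :: "'a::ring \<Rightarrow> 'a"
  assumes add: "additive T"
    and sq: "\<And>x. nsm k (T (x * x)) = weighted_mult p q x (T x)"
  defines "U \<equiv> weighted_mult p q"
  shows "U x (U y (U x (T x))) + nsm k (nsm k (U (x * x * y + y * (x * x)) (T x))) =
         nsm k (U (x * x) (U y (T x))) + nsm k (U (x * y + y * x) (U x (T x)))"
proof -
  have lin: "nsm k (T (a * b + b * a)) = U b (T a) + U a (T b)" for a b
    unfolding U_def by (rule weighted_jordan_linearized[OF add sq])
  have Uadd: "U a (v + w) = U a v + U a w" for a v w
    unfolding U_def by (rule weighted_mult_add)
  have Unsm: "nsm k (U a v) = U a (nsm k v)" for a v
    unfolding U_def by (rule weighted_mult_nsm[symmetric])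
  have sq': "nsm k (T (x * x)) = U x (T x)"
    unfolding U_def by (rule sq)
  have comm: "U x (U (x * x) v) = U (x * x) (U x v)" for v
    unfolding U_def by (rule weighted_mult_sq_commute)
  let ?u = "x * x * y + y * (x * x)" and ?v = "x * y + y * x"
  have sqU: "nsm k (U a (T (x * x))) = U a (U x (T x))" for a
    unfolding Unsm sq' by (rule refl)
  have lin2: "nsm k (U c (T (a * b + b * a))) = U c (U b (T a)) + U c (U a (T b))" for a b c
    unfolding Unsm lin by (rule Uadd)
  have 1: "nsm k (nsm k (nsm k (T (?u * x + x * ?u)))) =
      U x (U y (U x (T x))) + nsm k (U (x * x) (U x (T y))) + nsm k (nsm k (U ?u (T x)))"
    unfolding lin[of ?u x] nsm_add_right comm[symmetric] Unsm[of x] lin[of "x * x" y] sqU Uadd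
    by (rule refl)
  have 2: "nsm k (nsm k (nsm k (T (x * x * ?v + ?v * (x * x))))) =
      nsm k (U ?v (U x (T x))) + (nsm k (U (x * x) (U y (T x))) + nsm k (U (x * x) (U x (T y))))"
    unfolding lin[of "x * x" ?v] nsm_add_right sqU lin2 by (rule refl)
  have "?u * x + x * ?u = x * x * ?v + ?v * (x * x)"
    by (simp add: algebra_simps)
  then have "U x (U y (U x (T x))) + nsm k (U (x * x) (U x (T y))) + nsm k (nsm k (U ?u (T x))) =
      nsm k (U ?v (U x (T x))) + (nsm k (U (x * x) (U y (T x))) + nsm k (U (x * x) (U x (T y))))"
    using 1 2 by (simp only:)
  moreover have "a + b = d + c" if "a + p + b = c + (d + p)" for a b c d p :: 'a
    using that by (simp add: add_ac)
  ultimately show ?thesis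
    by blast
qed

text \<open>At weights \<open>m\<close> and \<open>0\<close> the Jordan identity has the common
  factor \<open>m * n\<close>, where \<open>n\<close> arises as \<open>(m + n) - m\<close>; it is
  cancelled.\<close>

lemma jordan_identity_right_weight:
  fixes S :: "'a::ring \<Rightarrow> 'a"
  assumes tm: "torsion_free m TYPE('a)" and tn: "torsion_free n TYPE('a)"
    and add: "additive S"
    and sq: "\<And>x. nsm (m + n) (S (x * x)) = nsm m (S x * x)"
  shows "nsm (m + n) (S x * x * x * y + S x * y * x * x) = nsm m (S x * x * y * x)"
proof -
  have sq': "nsm (m + n) (S (x * x)) = weighted_mult m 0 x (S x)" for x
    by (simp add: weighted_mult_def sq)
  have "nsm m (nsm n (nsm (m + n) (S x * x * x * y + S x * y * x * x))) =
      nsm m (nsm n (nsm m (S x * x * y * x)))"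
    using weighted_jordan_identity[OF add sq', of x y]
    by (simp add: weighted_mult_def nsm_simps nsm_commute[of n m] algebra_simps)
  then show ?thesis
    by (rule torsion_free_cancel[OF tn torsion_free_cancel[OF tm]])
qed

text \<open>With both weights present, the expanded Jordan identity again carries the factor
  \<open>m * n\<close>.\<close>

lemma jordan_identity_mn:
  fixes T :: "'a::ring \<Rightarrow> 'a"
  assumes tm: "torsion_free m TYPE('a)" and tn: "torsion_free n TYPE('a)"
    and add: "additive T"
    and sq: "\<And>x. nsm (m + n) (T (x * x)) = nsm m (T x * x) + nsm n (x * T x)"
  shows "nsm (m + n) (T x * x * x * y + T x * y * x * x + y * x * x * T x + x * x * y * T x) =
     nsm n (x * T x * x * y + x * T x * y * x + y * T x * x * x + x * y * x * T x) +
     nsm m (x * x * T x * y + T x * x * y * x + y * x * T x * x + x * y * T x * x)"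
    (is "nsm _ ?A = nsm _ ?B + nsm _ ?C")
proof -
  have sq': "nsm (m + n) (T (x * x)) = weighted_mult m n x (T x)" for x
    by (simp add: weighted_mult_def sq)
  have "nsm m (nsm n (nsm (m + n) ?A)) = nsm m (nsm n (nsm n ?B + nsm m ?C))"
    using weighted_jordan_identity[OF add sq', of x y]
    by (simp add: weighted_mult_def nsm_simps nsm_commute[of n m] algebra_simps)
  then show ?thesis
    by (rule torsion_free_cancel[OF tn torsion_free_cancel[OF tm]])
qed

section \<open>Vanishing of a map with left weight zero\<close>

lemma right_weight_jordan_zero:
  fixes S :: "'a::ring \<Rightarrow> 'a"
  assumes sp: "semiprime TYPE('a)"
    and t2: "torsion_free 2 TYPE('a)" and tm: "torsion_free m TYPE('a)"
    and tn: "torsion_free n TYPE('a)" and tk: "torsion_free (m + n) TYPE('a)"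
    and tl: "torsion_free (2 * n + m) TYPE('a)"
    and add: "additive S"
    and sq: "\<And>x. nsm (m + n) (S (x * x)) = nsm m (S x * x)"
  shows "S x = 0"
proof -
  note I = jordan_identity_right_weight[OF tm tn add sq]
  have s3: "S x * x * x * x = 0" for x
  proof (rule torsion_free_cancel[OF tl])
    \<comment> \<open>The identity at \<open>y = x\<close>; the torsion condition on
      \<open>2 * n + m\<close> comes from \<open>2 * (m + n) - m\<close>.\<close>
    have "nsm (m + n) (S x * x * x * x + S x * x * x * x) = nsm m (S x * x * x * x)"
      by (rule I)
    then show "nsm (2 * n + m) (S x * x * x * x) = nsm (2 * n + m) 0"
      by (simp add: mult_2 nsm_simps add_ac)
  qed
  have s2: "S x * x * x = 0" for x
  proof (rule semiprimeD[OF sp])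
    fix r
    have s3': "S x * (x * (x * (x * z))) = 0" for z
      using arg_cong[OF s3[of x], of "\<lambda>u. u * z"] by (simp add: mult.assoc)
    \<comment> \<open>This \<open>y\<close> puts \<open>S x * x * x * x\<close> into every term but
      one.\<close>
    have "nsm (m + n) (S x * x * x * (r * S x) * x * x) = nsm (m + n) 0"
      using I[of x "x * (x * (r * S x))"] by (simp add: mult.assoc s3')
    then show "S x * x * x * r * (S x * x * x) = 0"
      using torsion_free_cancel[OF tk] by (simp add: mult.assoc)
  qed
  have s1: "S x * x = 0" for x
  proof (rule semiprimeD[OF sp])
    fix r
    have s2': "S x * (x * (x * z)) = 0" for z
      using arg_cong[OF s2[of x], of "\<lambda>u. u * z"] by (simp add: mult.assoc)
    have "S x * (x * x) = 0"
      using s2[of x] by (simp add: mult.assoc)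
    \<comment> \<open>Now both terms on the left of the identity contain \<open>S x * x * x\<close>,
      and only its right side survives.\<close>
    then have "nsm m (S x * x * (r * S x) * x) = nsm m 0"
      using I[of x "r * S x"] by (simp add: mult.assoc s2')
    then show "S x * x * r * (S x * x) = 0"
      using torsion_free_cancel[OF tm] by (simp add: mult.assoc)
  qed
  have swap: "S x * y = - (S y * x)" for x y
    using s1[of "x + y"] by (simp add: additive_add[OF add] algebra_simps s1 eq_neg_iff_add_eq_0)
  have S2: "S (x * x) = 0" for x
    using sq[of x] torsion_free_cancel[OF tk, of "S (x * x)" 0] by (simp add: s1)
  have Sswap: "S (x * y) = - S (y * x)" for x y
    using S2[of "x + y"]
    by (simp add: additive_add[OF add] algebra_simps S2 eq_neg_iff_add_eq_0)
  have push: "S (y * z) * x = S y * x * z" for x y z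
  proof -
    have "S (y * z) * x = - (S x * y * z)"
      using swap[of "y * z" x] by (simp add: mult.assoc)
    then show ?thesis
      by (simp add: swap[of x y])
  qed
  have alt: "S x * y * z = - (S x * z * y)" for x y z
  proof -
    \<comment> \<open>\<open>push\<close> evaluates \<open>S (y * z) * x\<close> and
      \<open>S (z * y) * x\<close>, which are opposite by \<open>Sswap\<close>.\<close>
    have "S z * x * y = - (S y * x * z)"
      using push[of y z x] push[of z y x] Sswap[of y z] by (metis mult_minus_left minus_minus)
    then show ?thesis
      by (simp add: swap[of z x] swap[of y x])
  qed
  have zero: "S x * y * z * w = 0" for y z w
  proof -
    have cyc: "S x * y * z * w = - (S x * z * w * y)" for y z w
      using alt[of x y "z * w"] by (simp add: mult.assoc)
    \<comment> \<open>A cyclic shift of three factors changes the sign; three shifts restore the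
      order with sign -1.\<close>
    have "S x * y * z * w = - (S x * y * z * w)"
      using cyc[of y z w] cyc[of z w y] cyc[of w y z] by simp
    then have "nsm 2 (S x * y * z * w) = nsm 2 0"
      by (simp add: nsm_2 eq_neg_iff_add_eq_0)
    then show ?thesis
      by (rule torsion_free_cancel[OF t2])
  qed
  show ?thesis
    by (rule semiprime_cubeD[OF sp]) (simp add: zero)
qed

section \<open>From annihilating squares to commuting\<close>

lemma commuting_of_annihilates_square:
  fixes T :: "'a::ring \<Rightarrow> 'a"
  assumes sp: "semiprime TYPE('a)"
    and t2: "torsion_free 2 TYPE('a)" and t3: "torsion_free 3 TYPE('a)"
    and add: "additive T"
    and ann: "\<And>x y. (T x * x - x * T x) * y * (x * x) = 0"
  shows "T x * x = x * T x"
proof -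
  define D where "D = (\<lambda>x. T x * x - x * T x)"
  define Q where "Q = (\<lambda>x w. T x * w - w * T x + (T w * x - x * T w))"
  have DD: "D x * y * (x * x) = 0" for x y
    unfolding D_def by (rule ann)
  have lin: "D x * y * (x * w + w * x) + Q x w * y * (x * x) = 0" for x y w
  proof -
    \<comment> \<open>\<open>e1\<close>, \<open>e2\<close>, \<open>e3\<close> are the parts of
      degree 1, 2, 3 in \<open>w\<close> of the relation at \<open>x + w\<close>. Replacing
      \<open>w\<close> by \<open>- w\<close> and by \<open>w + w\<close> separates them.\<close>
    define e1 where "e1 = (\<lambda>w. D x * y * (x * w + w * x) + Q x w * y * (x * x))"
    define e2 where "e2 = (\<lambda>w. D x * y * (w * w) + Q x w * y * (x * w + w * x) + D w * y * (x * x))"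
    define e3 where "e3 = (\<lambda>w. Q x w * y * (w * w) + D w * y * (x * w + w * x))"
    have Dadd: "D (x + w) = D x + Q x w + D w" for w
      by (simp add: D_def Q_def additive_add[OF add] algebra_simps)
    have E: "e1 w + e2 w + e3 w = 0" for w
    proof -
      have "D (x + w) * y * ((x + w) * (x + w)) =
          D x * y * (x * x) + (e1 w + e2 w + e3 w) + D w * y * (w * w)"
        unfolding Dadd e1_def e2_def e3_def by (simp add: algebra_simps)
      then show ?thesis
        by (simp add: DD)
    qed
    have Dm: "D (- w) = D w" "Q x (- w) = - Q x w"
      by (simp_all add: D_def Q_def additive_minus[OF add] algebra_simps)
    have D2: "D (w + w) = D w + D w + (D w + D w)" "Q x (w + w) = Q x w + Q x w"
      by (simp_all add: D_def Q_def additive_add[OF add] algebra_simps)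
    have "e1 (- w) + e2 (- w) + e3 (- w) = - e1 w + e2 w - e3 w"
      unfolding e1_def e2_def e3_def Dm by (simp add: algebra_simps)
    then have "- e1 w + e2 w - e3 w = 0"
      by (simp only: E)
    then have odd: "e2 w = e1 w + e3 w"
      by (simp add: algebra_simps)
    then have "nsm 2 (e2 w) = nsm 2 0"
      using E[of w] by (simp add: nsm_2 add_ac)
    then have e20: "e2 w = 0"
      by (rule torsion_free_cancel[OF t2])
    with odd have e31: "e3 w = - e1 w"
      by (simp add: eq_neg_iff_add_eq_0 add.commute)
    have "e1 (w + w) + e2 (w + w) + e3 (w + w) =
        nsm 2 (e1 w) + nsm 2 (nsm 2 (e2 w)) + nsm 2 (nsm 2 (nsm 2 (e3 w)))"
      unfolding e1_def e2_def e3_def D2 by (simp add: nsm_2 algebra_simps)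
    then have "nsm 2 (e1 w) + nsm 2 (nsm 2 (e2 w)) + nsm 2 (nsm 2 (nsm 2 (e3 w))) = 0"
      by (simp only: E)
    \<comment> \<open>With \<open>e2 w = 0\<close> and \<open>e3 w = - e1 w\<close> the sum is 2 - 8
      = -6 times \<open>e1 w\<close>.\<close>
    then have "nsm 2 (nsm 3 (e1 w)) = nsm 2 0"
      by (simp add: e20 e31 nsm_2 numeral_3_eq_3 nsm_Suc nsm_simps neg_eq_iff_add_eq_0 algebra_simps)
    then have "e1 w = 0"
      using torsion_free_cancel[OF t2] torsion_free_cancel[OF t3] by (metis nsm_zero)
    then show ?thesis
      by (simp add: e1_def)
  qed
  have "D x * y * (x * w + w * x) = 0" (is "?g = 0") for y w
  proof (rule semiprimeD[OF sp])
    fix r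
    have sym: "(x * x) * r * D x = 0" for r
      by (rule semiprime_annihilator_sym[OF sp DD])
    have "?g = - (Q x w * y * (x * x))"
      using lin[of x y w] by (simp add: eq_neg_iff_add_eq_0)
    then have "?g * r * ?g = - (Q x w * y * (x * x)) * r * ?g"
      by simp
    also have "\<dots> = - (Q x w * y * (x * x * r * D x) * y * (x * w + w * x))"
      by (simp only: mult.assoc mult_minus_left)
    finally show "?g * r * ?g = 0"
      by (simp add: sym)
  qed
  then have anti: "D x * y * x * w = - (D x * y * w * x)" for y w
    by (simp add: eq_neg_iff_add_eq_0 distrib_left mult.assoc)
  have vanish: "D x * y * x * w * v = 0" for y w v
  proof -
    \<comment> \<open>Moving \<open>x\<close> past \<open>w * v\<close> at once costs one sign, past
      \<open>w\<close> and \<open>v\<close> separately two.\<close>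
    have "D x * y * x * w * v = - (D x * y * w * v * x)"
      using anti[of y "w * v"] by (simp add: mult.assoc)
    also have "\<dots> = D x * y * w * x * v"
      using anti[of "y * w" v] by (simp add: mult.assoc)
    also have "\<dots> = - (D x * y * x * w * v)"
      by (simp add: anti[of y w])
    finally have "nsm 2 (D x * y * x * w * v) = nsm 2 0"
      by (simp add: nsm_2 eq_neg_iff_add_eq_0)
    then show ?thesis
      by (rule torsion_free_cancel[OF t2])
  qed
  have Dx: "D x * y * x = 0" for y
    by (rule semiprime_cubeD[OF sp]) (simp add: vanish)
  have "D x = 0"
  proof (rule semiprimeD[OF sp])
    fix r
    have "D x * r * D x = D x * (r * T x) * x - D x * r * x * T x"
      by (subst (2) D_def) (simp add: algebra_simps)
    then show "D x * r * D x = 0"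
      by (simp only: Dx) simp
  qed
  then show ?thesis
    by (simp add: D_def)
qed

section \<open>The commutator of x and T x annihilates the square of x\<close>

lemma mn_jordan_commutator_annihilates_square:
  fixes T :: "'a::ring \<Rightarrow> 'a"
  assumes sp: "semiprime TYPE('a)"
    and tm: "torsion_free m TYPE('a)" and tn: "torsion_free n TYPE('a)"
    and tk: "torsion_free (m + n) TYPE('a)"
    and add: "additive T"
    and sq: "\<And>x. nsm (m + n) (T (x * x)) = nsm m (T x * x) + nsm n (x * T x)"
  shows "(T x * x - x * T x) * y * (x * x) = 0"
proof -
  define t where "t = T x"
  define d where "d = t * x - x * t"
  \<comment> \<open>\<open>c\<close> is the commutator of \<open>t\<close> with
    \<open>x * x\<close>, and \<open>e + f\<close> is \<open>m + n\<close> times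
    \<open>c\<close>.\<close>
  define c where "c = x * d + d * x"
  define e where "e = nsm n (x * d) + nsm m (d * x)"
  define f where "f = nsm m (x * d) + nsm n (d * x)"
  define p where "p = d * x * x"
  define J where "J = (\<lambda>y.
     nsm (m + n) (t * x * x * y + t * y * x * x + y * x * x * t + x * x * y * t) -
     nsm n (x * t * x * y + x * t * y * x + y * t * x * x + x * y * x * t) -
     nsm m (x * x * t * y + t * x * y * x + y * x * t * x + x * y * t * x))"
  have J: "J y = 0" for y
    using jordan_identity_mn[OF tm tn add sq, of x y] unfolding J_def t_def by simp
  \<comment> \<open>In \<open>J y * x - J (y * x)\<close> the terms with \<open>t\<close> left of
    \<open>y\<close> cancel, so \<open>G\<close> has \<open>d\<close> only to the right of
    \<open>y\<close>; \<open>H\<close> below is its mirror image.\<close>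
  define G where "G = (\<lambda>y. nsm (m + n) (x * x * y * d + y * x * x * d) -
     nsm m (y * x * d * x + x * y * d * x) - nsm n (y * d * x * x + x * y * x * d))"
  have G: "G y = 0" for y
  proof -
    have "G y = J y * x - J (y * x)"
      by (simp add: G_def J_def d_def nsm_simps algebra_simps)
    then show ?thesis
      by (simp add: J)
  qed
  define H where "H = (\<lambda>y. nsm (m + n) (d * x * x * y + d * y * x * x) -
     nsm n (x * d * x * y + x * d * y * x) - nsm m (x * x * d * y + d * x * y * x))"
  have H: "H y = 0" for y
  proof -
    have "H y = J (x * y) - x * J y"
      by (simp add: H_def J_def d_def nsm_simps algebra_simps)
    then show ?thesis
      by (simp add: J)
  qed
  have de: "d * y * e = nsm (m + n) (c * y * d)" for y
  proof -
    \<comment> \<open>Terms of \<open>G\<close> starting with \<open>y\<close> cancel here; the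
      others exchange their leading \<open>x * x\<close> or \<open>x\<close> for its commutator with
      \<open>t\<close>.\<close>
    have "nsm (m + n) (c * y * d) - d * y * e = t * G y - G (t * y)"
      by (simp add: G_def c_def e_def d_def nsm_simps algebra_simps)
    then show ?thesis
      by (simp add: G)
  qed
  have dc: "d * y * c = c * y * d" for y
  proof -
    let ?P = "d * y * c - c * y * d"
    have Pd: "?P * z * d = 0" for z
    proof -
      \<comment> \<open>\<open>d * y * d * z * e\<close> is evaluated twice by \<open>de\<close>,
        with middle factor \<open>z\<close> and with \<open>y * d * z\<close>.\<close>
      have "nsm (m + n) (d * y * c * z * d) = d * y * nsm (m + n) (c * z * d)"
        by (simp only: nsm_mult_right mult.assoc)
      also have "\<dots> = d * y * (d * z * e)"
        by (simp only: de)
      also have "\<dots> = d * (y * d * z) * e"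
        by (simp add: mult.assoc)
      also have "\<dots> = nsm (m + n) (c * y * d * z * d)"
        unfolding de by (simp add: mult.assoc)
      finally have "d * y * c * z * d = c * y * d * z * d"
        by (rule torsion_free_cancel[OF tk])
      then show ?thesis
        by (simp add: left_diff_distrib)
    qed
    have "?P = 0"
    proof (rule semiprimeD[OF sp])
      fix r
      have "?P * r * ?P = ?P * r * d * (y * c) - ?P * (r * c * y) * d"
        by (simp add: algebra_simps)
      then show "?P * r * ?P = 0"
        by (simp only: Pd) simp
    qed
    then show ?thesis
      by simp
  qed
  have df: "d * y * f = 0" for y
  proof -
    have "d * y * f = nsm (m + n) (d * y * c) - d * y * e"
      by (simp add: f_def c_def e_def nsm_simps algebra_simps)
    then show ?thesis
      by (simp add: de dc)
  qed
  have f0: "f = 0"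
  proof (rule semiprimeD[OF sp])
    fix r
    have "f * r * f = nsm m (x * (d * r * f)) + nsm n (d * (x * r) * f)"
      by (subst (1) f_def) (simp add: nsm_simps algebra_simps)
    then show "f * r * f = 0"
      by (simp add: df)
  qed
  have K: "d * x * x * y - c * y * x + d * y * x * x = 0" for y
  proof (rule torsion_free_cancel[OF tk])
    \<comment> \<open>Adding multiples of \<open>f\<close>, already zero, turns all coefficients of
      \<open>H\<close> into \<open>m + n\<close>.\<close>
    have "nsm (m + n) (d * x * x * y - c * y * x + d * y * x * x) = H y + x * f * y - f * y * x"
      by (simp add: H_def f_def c_def nsm_simps algebra_simps)
    then show "nsm (m + n) (d * x * x * y - c * y * x + d * y * x * x) = nsm (m + n) 0"
      by (simp add: H f0)
  qed
  have xd: "nsm m (x * d) = - nsm n (d * x)"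
    using f0 by (simp add: f_def eq_neg_iff_add_eq_0)
  have pd: "nsm m (p * y * d) = - nsm n (d * y * p)" for y
  proof -
    have "p * y * d - c * y * d * x + d * y * d * x * x = 0"
      using K[of "y * d"] by (simp add: p_def mult.assoc)
    then have "p * y * d = d * y * (x * d) * x"
      unfolding dc[symmetric] by (simp add: c_def algebra_simps)
    then have "nsm m (p * y * d) = d * y * nsm m (x * d) * x"
      by (simp add: nsm_simps)
    then show ?thesis
      by (simp add: xd p_def nsm_simps mult.assoc)
  qed
  have ddp: "d * y * d * z * p = 0" for y z
  proof -
    \<comment> \<open>\<open>p\<close> is carried across two factors \<open>d\<close> in two steps,
      giving coefficients \<open>m * m\<close> and \<open>n * n\<close>, then in one step, giving
      \<open>m\<close> and \<open>- n\<close>. Together they leave the factor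
      \<open>n * (m + n)\<close>.\<close>
    have "nsm m (nsm m (p * y * d * z * d)) = nsm m (nsm m (p * y * d) * z * d)"
      by (simp add: nsm_simps)
    also have "\<dots> = - nsm n (d * y * nsm m (p * z * d))"
      unfolding pd[of y] by (simp add: nsm_simps nsm_commute[of n m] mult.assoc)
    also have "\<dots> = nsm n (nsm n (d * y * d * z * p))"
      unfolding pd[of z] by (simp add: nsm_simps mult.assoc)
    finally have 1: "nsm m (nsm m (p * y * d * z * d)) = \<dots>" .
    have "nsm m (p * y * d * z * d) = - nsm n (d * y * d * z * p)"
      using pd[of "y * d * z"] by (simp add: mult.assoc)
    with 1 have "nsm m (- nsm n (d * y * d * z * p)) = nsm n (nsm n (d * y * d * z * p))"
      by simp
    then have "nsm n (nsm (m + n) (d * y * d * z * p)) = nsm n 0"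
      by (simp add: nsm_simps nsm_commute[of n m] minus_equation_iff eq_neg_iff_add_eq_0)
        (metis add.commute add.left_inverse)
    then have "nsm (m + n) (d * y * d * z * p) = nsm (m + n) 0"
      using torsion_free_cancel[OF tn] by simp
    then show ?thesis
      by (rule torsion_free_cancel[OF tk])
  qed
  have p0: "p = 0"
  proof (rule semiprimeD[OF sp])
    fix r
    show "p * r * p = 0"
    proof (rule semiprimeD[OF sp])
      fix s
      have "p * r * p * s * (p * r * p) = d * (x * x * r) * d * (x * x * s) * p * (r * p)"
        by (simp add: p_def mult.assoc)
      then show "p * r * p * s * (p * r * p) = 0"
        by (simp only: ddp) simp
    qed
  qed
  have xdx: "x * d * x = 0"
  proof (rule torsion_free_cancel[OF tm])
    have "nsm m (x * d * x) = - nsm n p"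
      using arg_cong[OF xd, of "\<lambda>u. u * x"] by (simp add: nsm_simps p_def)
    then show "nsm m (x * d * x) = nsm m 0"
      by (simp add: p0)
  qed
  have xxd: "x * x * d = 0"
  proof (rule torsion_free_cancel[OF tm])
    have "nsm m (x * x * d) = - nsm n (x * d * x)"
      using arg_cong[OF xd, of "\<lambda>u. x * u"] by (simp add: nsm_simps mult.assoc)
    then show "nsm m (x * x * d) = nsm m 0"
      by (simp add: xdx)
  qed
  have cd: "c * y * x = d * y * x * x" for y
    using K[of y] p0 by (simp add: p_def)
  have c0: "c = 0"
  proof (rule semiprimeD[OF sp])
    fix r
    \<comment> \<open>Splitting the second \<open>c\<close> exposes a factor \<open>x\<close> on
      which \<open>cd\<close> acts.\<close>
    have "c * r * c = c * r * x * d + c * (r * d) * x"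
      by (simp add: c_def algebra_simps)
    also have "\<dots> = d * r * (x * x * d) + d * r * p"
      unfolding cd by (simp add: p_def mult.assoc)
    finally show "c * r * c = 0"
      by (simp add: xxd p0)
  qed
  have "d * y * x * x = 0"
    using cd[of y] c0 by simp
  then show ?thesis
    by (simp add: d_def t_def mult.assoc)
qed

section \<open>Zalar's argument and the passage to two-sided centralizers\<close>

text \<open>The defect \<open>B x y\<close> is biadditive and skew. It annihilates all commutators,
  hence is central, and then its square vanishes.\<close>

lemma jordan_left_centralizer:
  fixes T :: "'a::ring \<Rightarrow> 'a"
  assumes sp: "semiprime TYPE('a)" and t2: "torsion_free 2 TYPE('a)"
    and add: "additive T"
    and sq: "\<And>x. T (x * x) = T x * x"
  shows "T (x * y) = T x * y"
proof -
  note Tadd = additive_add[OF add] and Tdiff = additive_diff[OF add]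
  have lin: "T (x * y + y * x) = T x * y + T y * x" for x y
    using sq[of "x + y"] by (simp add: Tadd algebra_simps sq)
  have tri: "T (x * y * x) = T x * y * x" for x y
  proof (rule torsion_free_cancel[OF t2])
    let ?u = "x * y + y * x"
    \<comment> \<open>Twice \<open>x * y * x\<close> is a combination of Jordan products, to which
      \<open>lin\<close> applies.\<close>
    have "x * y * x + x * y * x = (x * ?u + ?u * x) - (x * x * y + y * (x * x))"
      by (simp add: algebra_simps)
    then have "T (x * y * x) + T (x * y * x) = T (x * ?u + ?u * x) - T (x * x * y + y * (x * x))"
      by (metis Tadd Tdiff)
    also have "\<dots> = T x * ?u + (T x * y + T y * x) * x - (T x * x * y + T y * (x * x))"
      by (simp only: lin sq)
    also have "\<dots> = T x * y * x + T x * y * x"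
      by (simp add: algebra_simps)
    finally show "nsm 2 (T (x * y * x)) = nsm 2 (T x * y * x)"
      by (simp add: nsm_2)
  qed
  have tri_lin: "T (x * y * z) + T (z * y * x) = T x * y * z + T z * y * x" for x y z
    using tri[of "x + z" y] by (simp add: Tadd algebra_simps tri[unfolded mult.assoc])
  define B where "B = (\<lambda>x y. T (x * y) - T x * y)"
  have Bswap: "B y x = - B x y" for x y
    using lin[of x y] by (simp add: B_def Tadd algebra_simps)
  have Badd1: "B (x + u) y = B x y + B u y" for x u y
    by (simp add: B_def Tadd algebra_simps)
  have Badd2: "B x (y + v) = B x y + B x v" for x y v
    by (simp add: B_def Tadd algebra_simps)
  have B1: "B x y * z * (x * y - y * x) = 0" for x y z
  proof -
    \<comment> \<open>The same element is bracketed in two ways, for \<open>tri_lin\<close> and for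
      \<open>tri\<close>.\<close>
    have "T (x * y) * z * (y * x) + T (y * x) * z * (x * y) =
        T (x * y * z * (y * x)) + T (y * x * z * (x * y))"
      by (rule tri_lin[symmetric])
    also have "\<dots> = T (x * (y * z * y) * x) + T (y * (x * z * x) * y)"
      by (simp add: mult.assoc)
    also have "\<dots> = T x * (y * z * y) * x + T y * (x * z * x) * y"
      by (simp only: tri)
    finally have "B x y * z * (y * x) + B y x * z * (x * y) = 0"
      by (simp add: B_def algebra_simps)
    then show ?thesis
      by (simp add: Bswap[of x y] algebra_simps)
  qed
  have B2: "B x y * z * (u * y - y * u) = 0" (is "?g = 0") for x y z u
  proof (rule semiprimeD[OF sp])
    fix r
    have "B (x + u) y * z * ((x + u) * y - y * (x + u)) =
      B x y * z * (x * y - y * x) + ?g + B u y * z * (x * y - y * x) + B u y * z * (u * y - y * u)"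
      by (simp add: Badd1 algebra_simps)
    then have g: "?g = - (B u y * z * (x * y - y * x))"
      by (simp add: B1 eq_neg_iff_add_eq_0)
    \<comment> \<open>Rewriting only the second factor by \<open>g\<close> leaves
      \<open>B x y\<close> in front and the commutator of \<open>x\<close> and \<open>y\<close> at
      the end, so \<open>B1\<close> applies.\<close>
    have "?g * r * ?g = - (B x y * (z * (u * y - y * u) * r * B u y * z) * (x * y - y * x))"
      by (subst (2) g) (simp only: mult.assoc mult_minus_right)
    then show "?g * r * ?g = 0"
      by (simp only: B1) simp
  qed
  have B3: "B x y * z * (u * v - v * u) = 0" (is "?g = 0") for x y z u v
  proof (rule semiprimeD[OF sp])
    fix r
    have "B x (y + v) * z * (u * (y + v) - (y + v) * u) =
      B x y * z * (u * y - y * u) + ?g + B x v * z * (u * y - y * u) + B x v * z * (u * v - v * u)"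
      by (simp add: Badd2 algebra_simps)
    then have g: "?g = - (B x v * z * (u * y - y * u))"
      by (simp add: B2 eq_neg_iff_add_eq_0)
    have "?g * r * ?g = - (B x y * (z * (u * v - v * u) * r * B x v * z) * (u * y - y * u))"
      by (subst (2) g) (simp only: mult.assoc mult_minus_right)
    then show "?g * r * ?g = 0"
      by (simp only: B2) simp
  qed
  define b where "b = B x y"
  have bz: "b * z * (u * v - v * u) = 0" for z u v
    unfolding b_def by (rule B3)
  have central: "b * v = v * b" for v
  proof -
    have "b * v - v * b = 0"
    proof (rule semiprimeD[OF sp])
      fix r
      have "(b * v - v * b) * r * (b * v - v * b) =
          b * (v * r) * (b * v - v * b) - v * (b * r * (b * v - v * b))"
        by (simp add: algebra_simps)
      then show "(b * v - v * b) * r * (b * v - v * b) = 0"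
        by (simp only: bz) simp
    qed
    then show ?thesis
      by simp
  qed
  have b_comm: "b * (u * v - v * u) = 0" (is "b * ?p = 0") for u v
  proof (rule semiprimeD[OF sp])
    fix r
    have "b * ?p * r * (b * ?p) = b * (?p * r * b) * ?p"
      by (simp only: mult.assoc)
    then show "b * ?p * r * (b * ?p) = 0"
      by (simp only: bz)
  qed
  have bT_comm: "b * T (u * v) = b * T (v * u)" for u v
  proof -
    let ?p = "u * v - v * u"
    have "b * ?p + ?p * b = 0"
      by (simp only: central[of ?p, symmetric] b_comm) simp
    then have "T b * ?p + T ?p * b = 0"
      using lin[of b ?p] additive_0[OF add] by simp
    then have eq: "b * T ?p = - (T b * ?p)"
      by (simp add: central[of "T ?p"] eq_neg_iff_add_eq_0 add.commute)
    have "b * T ?p = 0"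
    proof (rule semiprimeD[OF sp])
      fix r
      have "b * T ?p * r * (b * T ?p) = - (T b * ?p) * r * (b * T ?p)"
        by (simp only: eq)
      also have "\<dots> = - (T b * (?p * (r * b)) * T ?p)"
        by (simp only: mult.assoc mult_minus_left)
      also have "?p * (r * b) = b * ?p * r"
        using central[of "?p * r"] by (simp only: mult.assoc)
      finally show "b * T ?p * r * (b * T ?p) = 0"
        by (simp only: b_comm) simp
    qed
    then show ?thesis
      by (simp add: Tdiff right_diff_distrib)
  qed
  \<comment> \<open>After multiplication by \<open>b\<close>, \<open>T\<close> ignores the order of
    factors, so the Jordan product of \<open>u * u\<close> and \<open>w\<close> counts as twice
    \<open>u * w * u\<close>.\<close>
  have key: "b * T u * w * u = b * T w * u * u" for u w
  proof (rule torsion_free_cancel[OF t2])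
    have "b * T u * (u * w) = b * T u * (w * u)"
      using bz[of "T u" u w] by (simp add: right_diff_distrib)
    then have 1: "b * T u * u * w = b * T u * w * u"
      by (simp add: mult.assoc)
    have "b * T (u * w * u) = b * T (u * (u * w))" "b * T (w * (u * u)) = b * T (u * (u * w))"
      using bT_comm[of "u * w" u] bT_comm[of w "u * u"] by (simp_all add: mult.assoc)
    then have "b * T (u * u * w + w * (u * u)) = b * T (u * w * u) + b * T (u * w * u)"
      by (simp add: Tadd distrib_left mult.assoc)
    then have "b * (T u * u * w + T w * (u * u)) = b * (T u * w * u) + b * (T u * w * u)"
      unfolding lin sq tri .
    then show "nsm 2 (b * T u * w * u) = nsm 2 (b * T w * u * u)"
      using 1 by (simp add: nsm_2 distrib_left mult.assoc)
  qed
  let ?g = "T x * y - T y * x"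
  have gx: "b * ?g * x = 0" and gy: "b * ?g * y = 0"
    using key[of x y] key[of y x] by (simp_all add: algebra_simps)
  have bg: "b * ?g = 0"
  proof (rule semiprimeD[OF sp])
    fix r
    have swap: "b * ?g * (w * v) = b * ?g * v * w" for v w
      using bz[of ?g w v] by (simp add: right_diff_distrib mult.assoc)
    have "b * ?g * r * (b * ?g) = b * ?g * (r * b * T x * y) - b * ?g * (r * b * T y * x)"
      by (simp only: right_diff_distrib mult.assoc)
    also have "\<dots> = 0"
      unfolding swap gx gy by simp
    finally show "b * ?g * r * (b * ?g) = 0" .
  qed
  \<comment> \<open>This is \<open>B x y - B y x\<close>; multiplication by \<open>b\<close> kills
    every term on the right.\<close>
  have "b + b = T (x * y) - T (y * x) - ?g"
    using Bswap[of x y] by (simp add: b_def B_def algebra_simps)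
  then have "b * (b + b) = b * T (x * y) - b * T (y * x) - b * ?g"
    by (simp only: right_diff_distrib)
  then have "nsm 2 (b * b) = nsm 2 0"
    unfolding bg bT_comm[of x y] by (simp add: nsm_2 distrib_left)
  then have bb: "b * b = 0"
    by (rule torsion_free_cancel[OF t2])
  have "b = 0"
  proof (rule semiprimeD[OF sp])
    fix r
    have "b * r * b = b * b * r"
      by (simp only: central[of r, symmetric] mult.assoc)
    then show "b * r * b = 0"
      by (simp add: bb)
  qed
  then show ?thesis
    by (simp add: b_def B_def)
qed

text \<open>The defect \<open>h\<close> is skew by polarization of \<open>com\<close>, and right
  factors of either argument can be pulled out. Doing so in two orders makes \<open>h x y\<close>
  annihilate commutators, so it is central and, being nilpotent, zero.\<close>

lemma commuting_left_centralizer_right: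
  fixes T :: "'a::ring \<Rightarrow> 'a"
  assumes sp: "semiprime TYPE('a)" and add: "additive T"
    and com: "\<And>x. T x * x = x * T x"
    and left: "\<And>x y. T (x * y) = T x * y"
  shows "T x * y = x * T y"
proof -
  define h where "h = (\<lambda>x y. T x * y - x * T y)"
  have hswap: "h y x = - h x y" for x y
    using com[of "x + y"] by (simp add: h_def additive_add[OF add] com algebra_simps)
  have h2: "h x (y * z) = h x y * z" for x y z
    by (simp add: h_def left left_diff_distrib mult.assoc)
  have h1: "h (x * z) y = h x y * z" for x y z
    using hswap[of y "x * z"] hswap[of y x] by (simp add: h2)
  have h_comm: "h x y * (z * w) = h x y * (w * z)" for x y z w
  proof -
    have "h x y * z * w = h x (y * z) * w"
      by (simp only: h2)
    also have "\<dots> = h (x * w) (y * z)"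
      by (simp only: h1)
    also have "\<dots> = h (x * w) y * z"
      by (simp only: h2)
    also have "\<dots> = h x y * w * z"
      by (simp only: h1)
    finally show ?thesis
      by (simp add: mult.assoc)
  qed
  define b where "b = h x y"
  have bc: "b * (z * w) = b * (w * z)" for z w
    unfolding b_def by (rule h_comm)
  have bz: "b * r * (z * w - w * z) = 0" for r z w
    using h_comm[of x "y * r" z w] by (simp add: b_def h2 right_diff_distrib)
  have central: "b * v = v * b" for v
  proof -
    have "b * v - v * b = 0"
    proof (rule semiprimeD[OF sp])
      fix r
      have "(b * v - v * b) * r * (b * v - v * b) =
          b * (v * r) * (b * v - v * b) - v * (b * r * (b * v - v * b))"
        by (simp add: algebra_simps)
      then show "(b * v - v * b) * r * (b * v - v * b) = 0"
        by (simp only: bz) simp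
    qed
    then show ?thesis
      by simp
  qed
  have bT: "b * T a = T b * a" for a
    using left[of b a] left[of a b] central[of a] central[of "T a"] by simp
  have "b * b = b * T x * y - b * (x * T y)"
    by (subst (2) b_def) (simp only: h_def right_diff_distrib mult.assoc)
  moreover have "b * (x * T y) = x * (b * T y)"
    using central[of x] by (metis mult.assoc)
  ultimately have "b * b = b * T x * y - x * (b * T y)"
    by simp
  then have "b * b = T b * x * y - x * T b * y"
    by (simp only: bT mult.assoc)
  \<comment> \<open>The difference is \<open>b\<close> times the commutator of \<open>T b\<close>
    and \<open>x\<close>, times \<open>y\<close>.\<close>
  then have "b * (b * b) = b * (T b * x) * y - b * (x * T b) * y"
    by (simp only: right_diff_distrib mult.assoc)
  then have b3: "b * (b * b) = 0"
    by (simp only: bc[of x "T b"]) simp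
  have "b * b = 0"
  proof (rule semiprimeD[OF sp])
    fix r
    have "b * b * r * (b * b) = b * (b * b) * (r * b)"
      by (metis central mult.assoc)
    then show "b * b * r * (b * b) = 0"
      by (simp add: b3)
  qed
  moreover have "b * r * b = b * b * r" for r
    by (simp only: central[of r, symmetric] mult.assoc)
  ultimately have "b = 0"
    using semiprimeD[OF sp, of b] by simp
  then show ?thesis
    by (simp add: b_def h_def)
qed

section \<open>Assembly for ordinary and generalized (m,n)-Jordan centralizers\<close>

lemma mn_jordan_centralizer_two_sided:
  fixes T :: "'a::ring \<Rightarrow> 'a"
  assumes sp: "semiprime TYPE('a)"
    and t2: "torsion_free 2 TYPE('a)" and t3: "torsion_free 3 TYPE('a)"
    and tm: "torsion_free m TYPE('a)" and tn: "torsion_free n TYPE('a)"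
    and tk: "torsion_free (m + n) TYPE('a)"
    and T: "mn_jordan_centralizer m n T"
  shows "two_sided_centralizer T"
proof -
  have add: "additive T"
    and sq: "nsm (m + n) (T (x * x)) = nsm m (T x * x) + nsm n (x * T x)" for x
    using T by (auto simp: mn_jordan_centralizer_def)
  have com: "T x * x = x * T x" for x
    by (rule commuting_of_annihilates_square[OF sp t2 t3 add
          mn_jordan_commutator_annihilates_square[OF sp tm tn tk add sq]])
  have "T (x * x) = T x * x" for x
    by (rule torsion_free_cancel[OF tk]) (simp only: sq com, simp only: nsm_add)
  then have left: "T (x * y) = T x * y" for x y
    by (rule jordan_left_centralizer[OF sp t2 add])
  have "T (x * y) = x * T y" for x y
    using commuting_left_centralizer_right[OF sp add com left] left by simp
  then show ?thesis
    by (simp add: two_sided_centralizer_def left_centralizer_def right_centralizer_def add left)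
qed

theorem theorem1p6:
  fixes T :: "'a::ring \<Rightarrow> 'a" and m n :: nat
  assumes "m \<ge> 1" and "n \<ge> 1"
    and "torsion_free (6 * m * n * (m + n) * (2 * n + m)) TYPE('a)"
    and "semiprime TYPE('a)"
    and "generalized_mn_jordan_centralizer m n T"
    and "T \<noteq> (\<lambda>_. 0)"
  shows "two_sided_centralizer T"
proof -
  \<comment> \<open>The factors \<open>2 * n + m\<close>, \<open>m + n\<close>, \<open>n\<close> and
    \<open>m\<close> are split off from the right, leaving 6.\<close>
  note tl = torsion_free_multD[OF assms(3)]
  note tk = torsion_free_multD[OF tl(1)]
  note tn = torsion_free_multD[OF tk(1)]
  note tm = torsion_free_multD[OF tn(1)]
  have t6: "torsion_free (2 * 3) TYPE('a)"
    using tm(1) by simp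
  note t23 = torsion_free_multD[OF t6]
  obtain T0 where addT: "additive T" and T0: "mn_jordan_centralizer m n T0"
    and gen: "\<And>x. nsm (m + n) (T (x * x)) = nsm m (T x * x) + nsm n (x * T0 x)"
    using assms(5) by (auto simp: generalized_mn_jordan_centralizer_def)
  have addT0: "additive T0"
    and sqT0: "nsm (m + n) (T0 (x * x)) = nsm m (T0 x * x) + nsm n (x * T0 x)" for x
    using T0 by (auto simp: mn_jordan_centralizer_def)
  define S where "S = (\<lambda>x. T x - T0 x)"
  have "additive S"
    using addT addT0 by (simp add: S_def additive_def)
  moreover have "nsm (m + n) (S (x * x)) = nsm m (S x * x)" for x
    by (simp only: S_def nsm_diff_right gen sqT0 left_diff_distrib) simp
  ultimately have "S x = 0" for x
    by (rule right_weight_jordan_zero[OF assms(4) t23(1) tm(2) tn(2) tk(2) tl(2)])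
  then have "T = T0"
    by (auto simp: S_def)
  then show ?thesis
    using mn_jordan_centralizer_two_sided[OF assms(4) t23 tm(2) tn(2) tk(2) T0] by simp
qed

end
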